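(* Let $X\subseteq\omega$ be an infinite set with uniqueness of sums, let $u\in\beta\omega$ and let $\langle u_n : n<\omega\rangle$ be a sequence of ultrafilters on $\omega$. If $u$ and each $u_n$ are $X$-adequate, then $\bigoplus_u u_n$ is $X$-adequate.
   Context: For $A\subseteq\omega$, $\mathrm{FS}(A)$ is the set of sums $\sum_{a\in F}a$ over finite nonempty $F\subseteq A$. A set $A\subseteq\omega$ has uniqueness of sums if whenever $a_1<\dots<a_n$ and $b_1<\dots<b_m$ are elements of $A$ with $a_1+\dots+a_n=b_1+\dots+b_m$, then $n=m$ and $a_i=b_i$ for all $i$. For an infinite $X\subseteq\omega$ with increasing enumeration $\langle x_n : n<\omega\rangle$, a set $A\subseteq\omega$ is $X$-adequate if $A\subseteq\mathrm{FS}(X)$ and for every subsequence $\langle x_{n_k} : k\ge1\rangle$ ($n_1<n_2<\cdots$) there is a unique $m\ge1$ with $x_{n_1}+\dots+x_{n_m}\in A$. An ultrafilter $u$ on $\omega$ is $X$-adequate if some $X$-adequate set belongs to $u$ and $\mathrm{FS}(Y)\in u$ for every cofinite $Y\subseteq X$. For $u\in\beta\omega$ and ultrafilters $u_n$ on $\omega$, $\bigoplus_u u_n=\{A\subseteq\omega : \{n : \{m : n+m\in A\}\in u_n\}\in u\}$ (the image of the Blass–Frolík sum under $(n,m)\mapsto n+m$). *)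

theory Defs
  imports "HOL-Library.Infinite_Set"
begin

definition FS :: "nat set \<Rightarrow> nat set" where
  "FS A = {\<Sum>F | F. finite F \<and> F \<noteq> {} \<and> F \<subseteq> A}"

text \<open>Strictly increasing nonempty lists are the tuples $a_1 < \dots < a_n$ with $n \ge 1$;
  equality of lists expresses $n = m$ and $a_i = b_i$ for all $i$.\<close>

definition uniqueness_of_sums :: "nat set \<Rightarrow> bool" where
  "uniqueness_of_sums A \<longleftrightarrow>
    (\<forall>as bs. as \<noteq> [] \<and> sorted_wrt (<) as \<and> set as \<subseteq> A \<and>
             bs \<noteq> [] \<and> sorted_wrt (<) bs \<and> set bs \<subseteq> A \<and>
             sum_list as = sum_list bs \<longrightarrow> as = bs)"

text \<open>For infinite \<open>X\<close>, \<open>enumerate X\<close> is the increasing enumeration.  The index sequence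
  \<open>r\<close> starts at \<open>0\<close>, so \<open>r k\<close> is $n_{k+1}$ and the sum over \<open>k < m\<close> is
  $x_{n_1} + \dots + x_{n_m}$.\<close>

definition adequate_set :: "nat set \<Rightarrow> nat set \<Rightarrow> bool" where
  "adequate_set X A \<longleftrightarrow>
    A \<subseteq> FS X \<and>
    (\<forall>r :: nat \<Rightarrow> nat. strict_mono r \<longrightarrow>
      (\<exists>!m. m \<ge> 1 \<and> (\<Sum>k<m. enumerate X (r k)) \<in> A))"

text \<open>For a filter \<open>u\<close>, membership of a set \<open>A\<close> in \<open>u\<close> is \<open>\<forall>\<^sub>F n in u. n \<in> A\<close>.
  Ultrafilters may be principal.\<close>

definition ultrafilter :: "'a filter \<Rightarrow> bool" where
  "ultrafilter u \<longleftrightarrow>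
    u \<noteq> bot \<and> (\<forall>A. (\<forall>\<^sub>F n in u. n \<in> A) \<or> (\<forall>\<^sub>F n in u. n \<notin> A))"

definition adequate_ultrafilter :: "nat set \<Rightarrow> nat filter \<Rightarrow> bool" where
  "adequate_ultrafilter X u \<longleftrightarrow>
    ultrafilter u \<and>
    (\<exists>A. adequate_set X A \<and> (\<forall>\<^sub>F n in u. n \<in> A)) \<and>
    (\<forall>Y. Y \<subseteq> X \<and> finite (X - Y) \<longrightarrow> (\<forall>\<^sub>F n in u. n \<in> FS Y))"

definition oplus_filter :: "nat filter \<Rightarrow> (nat \<Rightarrow> nat filter) \<Rightarrow> nat filter" where
  "oplus_filter u U = Abs_filter (\<lambda>P. \<forall>\<^sub>F n in u. \<forall>\<^sub>F m in U n. P (n + m))"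

lemma eventually_oplus_filter:
  "eventually P (oplus_filter u U) \<longleftrightarrow> (\<forall>\<^sub>F n in u. \<forall>\<^sub>F m in U n. P (n + m))"
  unfolding oplus_filter_def
proof (rule eventually_Abs_filter, rule is_filter.intro)
  show "\<forall>\<^sub>F n in u. \<forall>\<^sub>F m in U n. True"
    by simp
next
  fix P Q :: "nat \<Rightarrow> bool"
  assume "\<forall>\<^sub>F n in u. \<forall>\<^sub>F m in U n. P (n + m)" "\<forall>\<^sub>F n in u. \<forall>\<^sub>F m in U n. Q (n + m)"
  then show "\<forall>\<^sub>F n in u. \<forall>\<^sub>F m in U n. P (n + m) \<and> Q (n + m)"
    by (simp add: eventually_conj_iff)
next
  fix P Q :: "nat \<Rightarrow> bool"
  assume "\<forall>x. P x \<longrightarrow> Q x" "\<forall>\<^sub>F n in u. \<forall>\<^sub>F m in U n. P (n + m)"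
  then show "\<forall>\<^sub>F n in u. \<forall>\<^sub>F m in U n. Q (n + m)"
    by (auto elim!: eventually_mono)
qed

end

(* If A belongs to u and A' n to U n, all of them adequate, then the sums a + b with
   a in A, b in A' a and all summands of b above those of a form an adequate set: along any
   subsequence, read until the partial sum lies in A, then continue with the remaining
   subsequence until the sum of the newly read terms lies in A' a.  Uniqueness of sums makes this
   the only decomposition of a partial sum. *)

theory Submission
  imports Defs
begin

section \<open>Finite sets of summands and sums of ultrafilters\<close>

text \<open>A finite set is recovered from its increasing enumeration, so uniqueness for increasing
  lists transfers to finite sets, the form in which elements of \<open>FS X\<close> are
  given.\<close>

lemma uniqueness_of_sumsD:
  assumes "uniqueness_of_sums X"
    and F: "finite F" "F \<noteq> {}" "F \<subseteq> X"
    and G: "finite G" "G \<noteq> {}" "G \<subseteq> X"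
    and "\<Sum>F = \<Sum>G"
  shows "F = G"
proof -
  have sum: "sum_list (sorted_list_of_set H) = \<Sum>H" if "finite H" for H :: "nat set"
    using that sum_list_distinct_conv_sum_set[of "sorted_list_of_set H" "\<lambda>x. x"] by simp
  have "sorted_list_of_set F = sorted_list_of_set G"
    by (rule assms(1)[unfolded uniqueness_of_sums_def, rule_format])
      (use F G \<open>\<Sum>F = \<Sum>G\<close> in \<open>auto simp: sum\<close>)
  then show ?thesis
    using F G by (metis set_sorted_list_of_set)
qed

lemma FSE:
  assumes "a \<in> FS A"
  obtains F where "finite F" "F \<noteq> {}" "F \<subseteq> A" "a = \<Sum>F"
  using assms unfolding FS_def by blast

text \<open>The set \<open>A\<close> is decided in two stages: each \<open>U n\<close> decides the
  section of all \<open>m\<close> with \<open>n + m\<close> in \<open>A\<close>, and then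
  \<open>u\<close> decides the set of those \<open>n\<close> whose section is large.\<close>

lemma ultrafilter_oplus_filter:
  assumes u: "ultrafilter u" and U: "\<And>n. ultrafilter (U n)"
  shows "ultrafilter (oplus_filter u U)"
  unfolding ultrafilter_def
proof (intro conjI allI)
  have "\<not> eventually (\<lambda>_. False) (oplus_filter u U)"
    using u U by (simp add: eventually_oplus_filter ultrafilter_def)
  then show "oplus_filter u U \<noteq> bot"
    by (auto simp: eventually_bot)
next
  fix A
  let ?P = "\<lambda>n. \<forall>\<^sub>F m in U n. n + m \<in> A"
  have "(\<forall>\<^sub>F m in U n. m \<in> {m. n + m \<in> A}) \<or> (\<forall>\<^sub>F m in U n. m \<notin> {m. n + m \<in> A})" for n
    using U unfolding ultrafilter_def by blast
  then have not: "\<forall>\<^sub>F m in U n. n + m \<notin> A" if "\<not> ?P n" for n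
    using that by (metis (mono_tags, lifting) mem_Collect_eq eventually_mono)
  have "(\<forall>\<^sub>F n in u. n \<in> {n. ?P n}) \<or> (\<forall>\<^sub>F n in u. n \<notin> {n. ?P n})"
    using u unfolding ultrafilter_def by blast
  then have "eventually ?P u \<or> (\<forall>\<^sub>F n in u. \<not> ?P n)"
    by simp
  then show "(\<forall>\<^sub>F n in oplus_filter u U. n \<in> A) \<or> (\<forall>\<^sub>F n in oplus_filter u U. n \<notin> A)"
    unfolding eventually_oplus_filter
  proof
    assume "\<forall>\<^sub>F n in u. \<not> ?P n"
    then have "\<forall>\<^sub>F n in u. \<forall>\<^sub>F m in U n. n + m \<notin> A"
      by (rule eventually_mono) (rule not)
    then show "eventually ?P u \<or> (\<forall>\<^sub>F n in u. \<forall>\<^sub>F m in U n. n + m \<notin> A)" ..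
  qed simp
qed

section \<open>Block sums along a subsequence\<close>

text \<open>As \<open>F\<close> lies below \<open>G\<close> and \<open>s\<close> is increasing,
  every index of an element of \<open>F\<close> precedes every index of an element of
  \<open>G\<close>. The cut is the first index that lands in \<open>G\<close>.\<close>

lemma strict_mono_image_split:
  fixes s :: "nat \<Rightarrow> nat"
  assumes s: "strict_mono s" and FG: "F \<union> G = s ` {..<p}" and less: "\<forall>x\<in>F. \<forall>y\<in>G. x < y"
  obtains j where "j \<le> p" "F = s ` {..<j}" "G = s ` {j..<p}"
proof -
  \<comment> \<open>The disjunct \<open>j = p\<close> guarantees a witness, bounds the cut by
    \<open>p\<close>, and yields \<open>p\<close> when \<open>G\<close> is empty.\<close>
  define j where "j = (LEAST j. j = p \<or> s j \<in> G)"
  have j: "j = p \<or> s j \<in> G"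
    unfolding j_def by (rule LeastI[of _ p]) simp
  have below: "i \<noteq> p \<and> s i \<notin> G" if "i < j" for i
    using not_less_Least[OF that[unfolded j_def]] by simp
  have "j \<le> p"
    unfolding j_def by (rule Least_le) simp
  \<comment> \<open>Here \<open>j < p\<close>, hence \<open>s j\<close> is in \<open>G\<close>; if
    \<open>s i\<close> were in \<open>F\<close>, then \<open>s i < s j\<close>, against
    \<open>j \<le> i\<close>.\<close>
  have above: "s i \<notin> F" if "j \<le> i" "i < p" for i
    using j less that s by (metis leD le_less_linear strict_mono_less_eq order_le_less_trans)
  have mem: "s i \<in> F \<or> s i \<in> G" if "i < p" for i
    using FG that by blast
  have F: "F = s ` {..<j}"
  proof (intro equalityI subsetI)
    fix x assume "x \<in> F"
    then obtain i where "i < p" "x = s i" using FG by blast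
    with above[of i] \<open>x \<in> F\<close> show "x \<in> s ` {..<j}" by force
  next
    fix x assume "x \<in> s ` {..<j}"
    then obtain i where "i < j" "x = s i" by blast
    then show "x \<in> F" using below[of i] mem[of i] \<open>j \<le> p\<close> by simp
  qed
  have G: "G = s ` {j..<p}"
  proof (intro equalityI subsetI)
    fix x assume "x \<in> G"
    then obtain i where "i < p" "x = s i" using FG by blast
    with below[of i] \<open>x \<in> G\<close> show "x \<in> s ` {j..<p}" by force
  next
    fix x assume "x \<in> s ` {j..<p}"
    then obtain i where "j \<le> i" "i < p" "x = s i" by auto
    then show "x \<in> G" using above[of i] mem[of i] by simp
  qed
  from that[OF \<open>j \<le> p\<close> F G] show ?thesis .
qed

text \<open>Finite sets appear instead of bare numbers because the order condition concerns
  summands. The second set varies with the first sum, just as \<open>U n\<close> varies with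
  \<open>n\<close>.\<close>

definition block_sums :: "nat set \<Rightarrow> nat set \<Rightarrow> (nat \<Rightarrow> nat set) \<Rightarrow> nat set" where
  "block_sums X A A' = {\<Sum>F + \<Sum>G | F G.
    finite F \<and> F \<noteq> {} \<and> F \<subseteq> X \<and> finite G \<and> G \<noteq> {} \<and> G \<subseteq> X \<and>
    (\<forall>x\<in>F. \<forall>y\<in>G. x < y) \<and> \<Sum>F \<in> A \<and> \<Sum>G \<in> A' (\<Sum>F)}"

lemma sum_Un_less:
  fixes F G :: "nat set"
  assumes "finite F" "finite G" "\<forall>x\<in>F. \<forall>y\<in>G. x < y"
  shows "\<Sum>(F \<union> G) = \<Sum>F + \<Sum>G"
proof (rule sum.union_disjoint)
  show "F \<inter> G = {}"
    using assms(3) by (meson disjoint_iff less_irrefl)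
qed (use assms(1,2) in simp_all)

text \<open>Uniqueness of sums identifies \<open>F \<union> G\<close> with the first
  \<open>p\<close> terms, and the order condition turns this into a cut of these terms into two
  consecutive runs. Conversely, two consecutive nonempty runs are admissible choices of
  \<open>F\<close> and \<open>G\<close>.\<close>

lemma partial_sum_in_block_sums_iff:
  fixes s :: "nat \<Rightarrow> nat"
  assumes uniq: "uniqueness_of_sums X" and s: "strict_mono s" and sX: "range s \<subseteq> X"
    and p: "p \<ge> 1"
  shows "(\<Sum>k<p. s k) \<in> block_sums X A A' \<longleftrightarrow>
    (\<exists>m q. m \<ge> 1 \<and> q \<ge> 1 \<and> p = m + q \<and> (\<Sum>k<m. s k) \<in> A \<and>
      (\<Sum>k<q. s (k + m)) \<in> A' (\<Sum>k<m. s k))"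
    (is "?L \<longleftrightarrow> ?R")
proof -
  have inj: "inj s"
    using s by (rule strict_mono_imp_inj_on)
  have sum_image: "\<Sum>(s ` I) = (\<Sum>k\<in>I. s k)" for I
    using sum.reindex[of s I "\<lambda>x. x"] inj by (simp add: inj_on_subset)
  have shift: "(\<Sum>k = m..<m + q. s k) = (\<Sum>k<q. s (k + m))" for m q
    using sum.shift_bounds_nat_ivl[of s 0 m q] by (simp add: lessThan_atLeast0 add.commute)
  show ?thesis
  proof
    assume ?L
    then obtain F G where F: "finite F" "F \<noteq> {}" "F \<subseteq> X" and G: "finite G" "G \<noteq> {}" "G \<subseteq> X"
      and less: "\<forall>x\<in>F. \<forall>y\<in>G. x < y" and FA: "\<Sum>F \<in> A" and GA: "\<Sum>G \<in> A' (\<Sum>F)"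
      and eq: "(\<Sum>k<p. s k) = \<Sum>F + \<Sum>G"
      unfolding block_sums_def by blast
    have "F \<union> G = s ` {..<p}"
    proof (rule uniqueness_of_sumsD[OF uniq])
      show "\<Sum>(F \<union> G) = \<Sum>(s ` {..<p})"
        using F G less eq by (simp add: sum_Un_less sum_image)
      show "s ` {..<p} \<noteq> {}" "s ` {..<p} \<subseteq> X"
        using p sX by (auto simp: lessThan_empty_iff image_subset_iff)
    qed (use F G in auto)
    then obtain j where j: "j \<le> p" "F = s ` {..<j}" "G = s ` {j..<p}"
      using strict_mono_image_split[OF s _ less] by blast
    \<comment> \<open>The cut is proper because neither \<open>F\<close> nor \<open>G\<close> is
      empty.\<close>
    have "j \<ge> 1" "p - j \<ge> 1"
      using j F G by (auto simp: Suc_le_eq intro!: gr0I)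
    moreover have "\<Sum>F = (\<Sum>k<j. s k)" "\<Sum>G = (\<Sum>k<p - j. s (k + j))"
      using j shift[of j "p - j"] by (simp_all add: sum_image)
    ultimately show ?R
      using FA GA \<open>j \<le> p\<close> by (intro exI[of _ j] exI[of _ "p - j"]) auto
  next
    assume ?R
    then obtain m q where mq: "m \<ge> 1" "q \<ge> 1" "p = m + q"
      and A: "(\<Sum>k<m. s k) \<in> A" "(\<Sum>k<q. s (k + m)) \<in> A' (\<Sum>k<m. s k)"
      by blast
    have "\<forall>x\<in>s ` {..<m}. \<forall>y\<in>s ` {m..<p}. x < y"
      using s by (auto simp: strict_mono_less)
    moreover have "\<Sum>(s ` {..<m}) = (\<Sum>k<m. s k)" "\<Sum>(s ` {m..<p}) = (\<Sum>k<q. s (k + m))"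
      using mq shift by (simp_all add: sum_image)
    moreover have "(\<Sum>k<p. s k) = (\<Sum>k<m. s k) + (\<Sum>k<q. s (k + m))"
      using sum.atLeastLessThan_concat[of 0 m p s] mq shift by (simp add: lessThan_atLeast0)
    ultimately show ?L
      unfolding block_sums_def using mq A sX
      by (intro CollectI exI[of _ "s ` {..<m}"] exI[of _ "s ` {m..<p}"])
        (auto simp: lessThan_empty_iff)
  qed
qed

text \<open>Adequacy is used twice: \<open>A\<close> fixes the length \<open>m\<close> of the first
  run, and then the member of \<open>A'\<close> at its sum fixes the length \<open>q\<close> of the
  second. Only \<open>m + q\<close> remains possible.\<close>

lemma adequate_set_block_sums:
  assumes "infinite X" and uniq: "uniqueness_of_sums X"
    and A: "adequate_set X A" and A': "\<And>n. adequate_set X (A' n)"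
  shows "adequate_set X (block_sums X A A')"
  unfolding adequate_set_def
proof (intro conjI allI impI)
  show "block_sums X A A' \<subseteq> FS X"
  proof
    fix a assume "a \<in> block_sums X A A'"
    then obtain F G where FG: "finite F" "F \<noteq> {}" "F \<subseteq> X" "finite G" "G \<subseteq> X"
      and less: "\<forall>x\<in>F. \<forall>y\<in>G. x < y" and "a = \<Sum>F + \<Sum>G"
      unfolding block_sums_def by blast
    then have "a = \<Sum>(F \<union> G)"
      by (simp add: sum_Un_less)
    then show "a \<in> FS X"
      unfolding FS_def using FG by blast
  qed
next
  fix r :: "nat \<Rightarrow> nat" assume r: "strict_mono r"
  define s where "s = enumerate X \<circ> r"
  have s: "strict_mono s"
    using r strict_mono_enumerate[OF \<open>infinite X\<close>] by (simp add: s_def strict_mono_def)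
  have sX: "range s \<subseteq> X"
    unfolding s_def using enumerate_in_set[OF \<open>infinite X\<close>] by auto
  \<comment> \<open>Dropping the first \<open>i\<close> terms leaves a subsequence, so adequacy
    applies again. The offset is \<open>0\<close> for the first run and \<open>m\<close> for the
    second.\<close>
  have ex1: "\<exists>!m. m \<ge> 1 \<and> (\<Sum>k<m. s (k + i)) \<in> B" if "adequate_set X B" for B i
  proof -
    have "strict_mono (\<lambda>k. r (k + i))"
      using r by (simp add: strict_mono_def)
    with that have "\<exists>!m. m \<ge> 1 \<and> (\<Sum>k<m. enumerate X (r (k + i))) \<in> B"
      unfolding adequate_set_def by blast
    then show ?thesis
      by (simp only: s_def o_apply)
  qed
  obtain m where m: "m \<ge> 1" "(\<Sum>k<m. s k) \<in> A"
    and m_uniq: "\<And>m'. m' \<ge> 1 \<Longrightarrow> (\<Sum>k<m'. s k) \<in> A \<Longrightarrow> m' = m"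
    using ex1[OF A, of 0] unfolding add_0_right by blast
  obtain q where q: "q \<ge> 1" "(\<Sum>k<q. s (k + m)) \<in> A' (\<Sum>k<m. s k)"
    and q_uniq: "\<And>q'. q' \<ge> 1 \<Longrightarrow> (\<Sum>k<q'. s (k + m)) \<in> A' (\<Sum>k<m. s k) \<Longrightarrow> q' = q"
    using ex1[OF A'[of "\<Sum>k<m. s k"], of m] by (elim ex1E) blast
  have "\<exists>!p. p \<ge> 1 \<and> (\<Sum>k<p. s k) \<in> block_sums X A A'"
  proof (rule ex1I[of _ "m + q"])
    have "m + q \<ge> 1" using m by simp
    then show "m + q \<ge> 1 \<and> (\<Sum>k<m + q. s k) \<in> block_sums X A A'"
      using m q by (subst partial_sum_in_block_sums_iff[OF uniq s sX]) auto
  next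
    fix p assume "p \<ge> 1 \<and> (\<Sum>k<p. s k) \<in> block_sums X A A'"
    then have "\<exists>m q. m \<ge> 1 \<and> q \<ge> 1 \<and> p = m + q \<and> (\<Sum>k<m. s k) \<in> A \<and>
      (\<Sum>k<q. s (k + m)) \<in> A' (\<Sum>k<m. s k)"
      using partial_sum_in_block_sums_iff[OF uniq s sX, of p] by simp
    then obtain m' q' where m': "m' \<ge> 1" "(\<Sum>k<m'. s k) \<in> A" and "q' \<ge> 1" "p = m' + q'"
      "(\<Sum>k<q'. s (k + m')) \<in> A' (\<Sum>k<m'. s k)"
      by (elim exE conjE)
    \<comment> \<open>This must come before comparing \<open>q'\<close> with \<open>q\<close>, since
      the offset and the target set of the second run depend on \<open>m'\<close>.\<close>
    moreover have "m' = m"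
      using m' by (rule m_uniq)
    ultimately show "p = m + q"
      using q_uniq[of q'] by simp
  qed
  then show "\<exists>!m. m \<ge> 1 \<and> (\<Sum>k<m. enumerate X (r k)) \<in> block_sums X A A'"
    by (simp only: s_def o_apply)
qed

section \<open>Large sets for the sum ultrafilter\<close>

lemma adequate_ultrafilterD:
  assumes "adequate_ultrafilter X u" "Y \<subseteq> X" "finite (X - Y)"
  shows "\<forall>\<^sub>F n in u. n \<in> FS Y"
proof -
  have "\<forall>Y. Y \<subseteq> X \<and> finite (X - Y) \<longrightarrow> (\<forall>\<^sub>F n in u. n \<in> FS Y)"
    using assms(1) unfolding adequate_ultrafilter_def by (elim conjE)
  with assms(2,3) show ?thesis by blast
qed

text \<open>Once \<open>n\<close> is written as the sum of a finite \<open>F\<close>, the set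
  \<open>Y - F\<close> is still cofinite in \<open>X\<close>. Thus \<open>U n\<close> concentrates
  on sums with summands disjoint from \<open>F\<close>, and adding such a sum to \<open>n\<close>
  stays in \<open>FS Y\<close>.\<close>

lemma eventually_oplus_filter_FS:
  assumes X: "adequate_ultrafilter X u" "\<And>n. adequate_ultrafilter X (U n)"
    and Y: "Y \<subseteq> X" "finite (X - Y)"
  shows "\<forall>\<^sub>F n in oplus_filter u U. n \<in> FS Y"
  unfolding eventually_oplus_filter
proof (rule eventually_mono)
  show "\<forall>\<^sub>F n in u. n \<in> FS Y"
    using X(1) Y by (rule adequate_ultrafilterD)
next
  fix n assume "n \<in> FS Y"
  then obtain F where F: "finite F" "F \<noteq> {}" "F \<subseteq> Y" "n = \<Sum>F"
    by (rule FSE)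
  have "finite (X - (Y - F))"
    using Y F by (rule_tac finite_subset[of _ "(X - Y) \<union> F"]) auto
  then have "\<forall>\<^sub>F m in U n. m \<in> FS (Y - F)"
    using X(2) Y by (intro adequate_ultrafilterD[of X]) auto
  then show "\<forall>\<^sub>F m in U n. n + m \<in> FS Y"
  proof (rule eventually_mono)
    fix m assume "m \<in> FS (Y - F)"
    then obtain G where G: "finite G" "G \<subseteq> Y - F" "m = \<Sum>G"
      by (rule FSE)
    then have "F \<inter> G = {}"
      by blast
    then have "n + m = \<Sum>(F \<union> G)"
      using F G by (simp add: sum.union_disjoint)
    then show "n + m \<in> FS Y"
      unfolding FS_def using F G by blast
  qed
qed

text \<open>The order condition comes from the cofinite sets in the definition of adequacy: for
  \<open>n\<close> the sum of \<open>F\<close>, almost all \<open>m\<close> along \<open>U n\<close>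
  are sums of elements of \<open>X\<close> above \<open>Max F\<close>, and almost all lie in
  \<open>A' n\<close> too.\<close>

lemma eventually_oplus_filter_block_sums:
  assumes X: "\<And>n. adequate_ultrafilter X (U n)"
    and A: "\<forall>\<^sub>F n in u. n \<in> A" "A \<subseteq> FS X" and A': "\<And>n. \<forall>\<^sub>F m in U n. m \<in> A' n"
  shows "\<forall>\<^sub>F n in oplus_filter u U. n \<in> block_sums X A A'"
  unfolding eventually_oplus_filter
proof (rule eventually_mono[OF A(1)])
  fix n assume "n \<in> A"
  with A(2) have "n \<in> FS X" by (rule subsetD)
  then obtain F where F: "finite F" "F \<noteq> {}" "F \<subseteq> X" "n = \<Sum>F"
    by (rule FSE)
  have "finite (X - X \<inter> {Max F<..})"
    by (rule finite_subset[of _ "{..Max F}"]) auto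
  then have "\<forall>\<^sub>F m in U n. m \<in> FS (X \<inter> {Max F<..})"
    by (intro adequate_ultrafilterD[OF X]) simp_all
  with A'[of n] show "\<forall>\<^sub>F m in U n. n + m \<in> block_sums X A A'"
  proof eventually_elim
    fix m assume "m \<in> FS (X \<inter> {Max F<..})" "m \<in> A' n"
    then obtain G where G: "finite G" "G \<noteq> {}" "G \<subseteq> X \<inter> {Max F<..}" "m = \<Sum>G"
      by (auto elim: FSE)
    have "\<forall>x\<in>F. \<forall>y\<in>G. x < y"
      using F G by (auto simp: subset_iff)
    then show "n + m \<in> block_sums X A A'"
      unfolding block_sums_def using F G \<open>n \<in> A\<close> \<open>m \<in> A' n\<close>
      by (intro CollectI exI[of _ F] exI[of _ G]) auto
  qed
qed

theorem theorem2p12: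
  fixes X :: "nat set" and u :: "nat filter" and U :: "nat \<Rightarrow> nat filter"
  assumes "infinite X"
    and "uniqueness_of_sums X"
    and "adequate_ultrafilter X u"
    and "\<And>n. adequate_ultrafilter X (U n)"
  shows "adequate_ultrafilter X (oplus_filter u U)"
proof -
  obtain A where A: "adequate_set X A" "\<forall>\<^sub>F n in u. n \<in> A"
    using assms(3) unfolding adequate_ultrafilter_def by blast
  \<comment> \<open>The witnesses for different \<open>U n\<close> may differ, so a whole family of
    adequate sets is chosen.\<close>
  have "\<forall>n. \<exists>A. adequate_set X A \<and> (\<forall>\<^sub>F m in U n. m \<in> A)"
    using assms(4) by (simp add: adequate_ultrafilter_def)
  from choice[OF this] obtain A'
    where A': "\<And>n. adequate_set X (A' n)" "\<And>n. \<forall>\<^sub>F m in U n. m \<in> A' n"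
    by blast
  have "adequate_set X (block_sums X A A')"
    using assms(1,2) A(1) A'(1) by (rule adequate_set_block_sums)
  moreover have "\<forall>\<^sub>F n in oplus_filter u U. n \<in> block_sums X A A'"
    using assms(4) A A'(2)
    by (intro eventually_oplus_filter_block_sums) (auto simp: adequate_set_def)
  moreover have "ultrafilter (oplus_filter u U)"
    using assms(3,4) by (intro ultrafilter_oplus_filter) (auto simp: adequate_ultrafilter_def)
  moreover have "\<forall>\<^sub>F n in oplus_filter u U. n \<in> FS Y" if "Y \<subseteq> X" "finite (X - Y)" for Y
    using assms(3,4) that by (rule eventually_oplus_filter_FS)
  ultimately show ?thesis
    unfolding adequate_ultrafilter_def[of X "oplus_filter u U"] by (intro conjI exI allI impI) auto
qed

end
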